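(* Let $\Psi=(\Sigma,\mathit{ind})$ be a concurrent alphabet with a total order $\le$ on $\Sigma$. If a word $u\in\Sigma^*$ is in Foata canonical form (for sequential traces), then there exists a step sequence $w=A_1\ldots A_k$ over $\Psi$ in Foata canonical form (for step traces) such that $u=lex(w)$.
   Context: A concurrent alphabet is $\Psi=(\Sigma,\mathit{ind})$ with $\Sigma$ finite nonempty, $\mathit{ind}$ irreflexive and symmetric, $\mathit{dep}=(\Sigma\times\Sigma)\setminus\mathit{ind}$. Sequential trace equivalence $\equiv^\Sigma_\Psi$ on $\Sigma^*$: reflexive transitive closure of $uabz\sim ubaz$ for $(a,b)\in\mathit{ind}$. A word $u$ is in (sequential) Foata canonical form if $u=u_1\ldots u_n$ ($n\ge0$) with nonempty words $u_i$ such that the letters of each $u_i$ are pairwise independent and $u_i$ is lexicographically ($\le$-) minimal in its class $[u_i]$, and for each $i>1$ and each letter $a$ of $u_i$ there is a letter $b$ of $u_{i-1}$ with $(a,b)\in\mathit{dep}$. Steps over $\Psi$: nonempty sets of pairwise independent actions; $\equiv^{\mathbb{S}}_\Psi$ is the reflexive, symmetric, transitive closure of $vABz\sim v(A\cup B)z$ for steps with $A\times B\subseteq\mathit{ind}$. A step sequence $A_1\ldots A_k$ is in (step) Foata canonical form if for each $i$, whenever $Av\equiv^{\mathbb{S}}_\Psi A_i\ldots A_k$ with $A$ a step, then $A\subseteq A_i$. $lex(A)$ lists the elements of a step $A$ in increasing order; $lex(A_1\ldots A_k)=lex(A_1)\cdots lex(A_k)$. *)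

theory Defs
  imports Main
begin

locale concurrent_alphabet =
  fixes \<Sigma> :: "'a set" and ind :: "'a rel"
  assumes finite_alphabet: "finite \<Sigma>"
    and nonempty_alphabet: "\<Sigma> \<noteq> {}"
    and ind_on_alphabet: "ind \<subseteq> \<Sigma> \<times> \<Sigma>"
    and irrefl_ind: "irrefl ind"
    and sym_ind: "sym ind"

definition dep :: "'a set \<Rightarrow> 'a rel \<Rightarrow> 'a rel" where
  "dep \<Sigma> ind = (\<Sigma> \<times> \<Sigma>) - ind"

definition swap_adjacent :: "'a set \<Rightarrow> 'a rel \<Rightarrow> 'a list \<Rightarrow> 'a list \<Rightarrow> bool" where
  "swap_adjacent \<Sigma> ind x y \<longleftrightarrow>
     (\<exists>u \<in> lists \<Sigma>. \<exists>z \<in> lists \<Sigma>. \<exists>a b.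
        (a, b) \<in> ind \<and> x = u @ [a, b] @ z \<and> y = u @ [b, a] @ z)"

definition trace_equiv :: "'a set \<Rightarrow> 'a rel \<Rightarrow> 'a list \<Rightarrow> 'a list \<Rightarrow> bool" where
  "trace_equiv \<Sigma> ind = (swap_adjacent \<Sigma> ind)\<^sup>*\<^sup>*"

definition trace_class :: "'a set \<Rightarrow> 'a rel \<Rightarrow> 'a list \<Rightarrow> 'a list set" where
  "trace_class \<Sigma> ind u = {v \<in> lists \<Sigma>. trace_equiv \<Sigma> ind u v}"

text \<open>Pairwise independence of the letters of a word refers to occurrences; as \<open>ind\<close> is
  irreflexive, no letter can then occur twice.\<close>

definition indep_word :: "'a rel \<Rightarrow> 'a list \<Rightarrow> bool" where
  "indep_word ind u \<longleftrightarrow>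
     (\<forall>i < length u. \<forall>j < length u. i \<noteq> j \<longrightarrow> (u ! i, u ! j) \<in> ind)"

definition lex_minimal :: "'a::linorder set \<Rightarrow> 'a rel \<Rightarrow> 'a list \<Rightarrow> bool" where
  "lex_minimal \<Sigma> ind u \<longleftrightarrow> (\<forall>v \<in> trace_class \<Sigma> ind u. lexordp_eq u v)"

definition seq_foata :: "'a::linorder set \<Rightarrow> 'a rel \<Rightarrow> 'a list \<Rightarrow> bool" where
  "seq_foata \<Sigma> ind u \<longleftrightarrow>
     (\<exists>us. u = concat us \<and>
        (\<forall>v \<in> set us. v \<noteq> [] \<and> indep_word ind v \<and> lex_minimal \<Sigma> ind v) \<and>
        (\<forall>i. Suc i < length us \<longrightarrow>
           (\<forall>a \<in> set (us ! Suc i). \<exists>b \<in> set (us ! i). (a, b) \<in> dep \<Sigma> ind)))"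

definition steps :: "'a set \<Rightarrow> 'a rel \<Rightarrow> 'a set set" where
  "steps \<Sigma> ind = {A. A \<noteq> {} \<and> A \<subseteq> \<Sigma> \<and> pairwise (\<lambda>a b. (a, b) \<in> ind) A}"

definition merge_adjacent ::
    "'a set \<Rightarrow> 'a rel \<Rightarrow> 'a set list \<Rightarrow> 'a set list \<Rightarrow> bool" where
  "merge_adjacent \<Sigma> ind x y \<longleftrightarrow>
     (\<exists>v \<in> lists (steps \<Sigma> ind). \<exists>z \<in> lists (steps \<Sigma> ind).
      \<exists>A \<in> steps \<Sigma> ind. \<exists>B \<in> steps \<Sigma> ind.
        A \<times> B \<subseteq> ind \<and> x = v @ [A, B] @ z \<and> y = v @ [A \<union> B] @ z)"

definition step_trace_equiv ::
    "'a set \<Rightarrow> 'a rel \<Rightarrow> 'a set list \<Rightarrow> 'a set list \<Rightarrow> bool" where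
  "step_trace_equiv \<Sigma> ind = equivclp (merge_adjacent \<Sigma> ind)"

definition step_foata :: "'a set \<Rightarrow> 'a rel \<Rightarrow> 'a set list \<Rightarrow> bool" where
  "step_foata \<Sigma> ind w \<longleftrightarrow>
     (\<forall>i < length w. \<forall>A \<in> steps \<Sigma> ind. \<forall>v \<in> lists (steps \<Sigma> ind).
        step_trace_equiv \<Sigma> ind (A # v) (drop i w) \<longrightarrow> A \<subseteq> w ! i)"

definition lex_steps :: "'a::linorder set list \<Rightarrow> 'a list" where
  "lex_steps w = concat (map sorted_list_of_set w)"

end

theory Submission
  imports Defs
begin

text \<open>The witness replaces each factor of the Foata form of \<open>u\<close> by its set of letters; a
  lexicographically minimal factor is increasing, so listing that set in order gives the factor
  back. For the step Foata form, consider the letters that can be moved to the front of a step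
  sequence. They do not change under merging of steps, so a step \<open>A\<close> that starts an equivalent
  sequence consists of such letters. In a sequence where each letter depends on a letter of the
  preceding step, only letters of the first step can be moved to the front.\<close>

text \<open>Recursion along the sequence, rather than quantification over equivalent sequences, lets
  invariance be checked on a single merge.\<close>

fun can_lead :: "'a rel \<Rightarrow> 'a \<Rightarrow> 'a set list \<Rightarrow> bool" where
  "can_lead ind a [] \<longleftrightarrow> False"
| "can_lead ind a (B # w) \<longleftrightarrow> a \<in> B \<or> (\<forall>b \<in> B. (a, b) \<in> ind) \<and> can_lead ind a w"

lemma can_lead_append_cong:
  assumes "can_lead ind a x \<longleftrightarrow> can_lead ind a y"
  shows "can_lead ind a (v @ x) \<longleftrightarrow> can_lead ind a (v @ y)"
  using assms by (induction v) auto

text \<open>A letter of \<open>B\<close> is independent of all of \<open>A\<close>, so having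
  \<open>A\<close> in front does not block it; any letter outside \<open>A \<union> B\<close> has to
  pass both steps in either form. Symmetry turns \<open>A \<times> B \<subseteq> ind\<close> into
  the orientation that \<open>can_lead\<close> asks for.\<close>

lemma can_lead_merge_adjacent:
  assumes "sym ind" and "merge_adjacent \<Sigma> ind x y"
  shows "can_lead ind a x \<longleftrightarrow> can_lead ind a y"
proof -
  from assms(2) obtain v z A B where AB: "A \<times> B \<subseteq> ind"
    and xy: "x = v @ [A, B] @ z" "y = v @ [A \<union> B] @ z"
    unfolding merge_adjacent_def by blast
  have "(b, c) \<in> ind" if "b \<in> B" "c \<in> A" for b c
    using AB that symD[OF assms(1), of c b] by blast
  then have "can_lead ind a ([A, B] @ z) \<longleftrightarrow> can_lead ind a ([A \<union> B] @ z)"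
    by auto
  then show ?thesis
    unfolding xy by (rule can_lead_append_cong)
qed

lemma can_lead_step_trace_equiv:
  assumes "sym ind" and "step_trace_equiv \<Sigma> ind x y"
  shows "can_lead ind a x \<longleftrightarrow> can_lead ind a y"
  using assms(2) unfolding step_trace_equiv_def
  by (induction rule: equivclp_induct) (auto simp: can_lead_merge_adjacent[OF assms(1)])

text \<open>A letter outside the first step would have to pass it and lead the tail. By induction it
  lies in the second step, so it depends on some letter of the first and cannot pass.\<close>

lemma can_lead_imp_in_hd:
  assumes "\<And>i b. Suc i < length w \<Longrightarrow> b \<in> w ! Suc i \<Longrightarrow> \<exists>c \<in> w ! i. (b, c) \<notin> ind"
    and "can_lead ind a w"
  shows "a \<in> hd w"
  using assms
proof (induction w)
  case Nil
  then show ?case by simp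
next
  case (Cons B w)
  show ?case
  proof (rule ccontr)
    assume "a \<notin> hd (B # w)"
    with Cons.prems(2) have ind: "\<forall>b \<in> B. (a, b) \<in> ind" and lead: "can_lead ind a w"
      by auto
    then have "w \<noteq> []" by auto
    have "a \<in> hd w"
    proof (rule Cons.IH[OF _ lead])
      fix i b assume "Suc i < length w" "b \<in> w ! Suc i"
      then show "\<exists>c \<in> w ! i. (b, c) \<notin> ind"
        using Cons.prems(1)[of "Suc i" b] by simp
    qed
    with \<open>w \<noteq> []\<close> have "\<exists>c \<in> B. (a, c) \<notin> ind"
      using Cons.prems(1)[of 0 a] by (simp add: hd_conv_nth)
    with ind show False by blast
  qed
qed

text \<open>The dependence condition is inherited by each suffix \<open>drop i w\<close>. Every
  letter of \<open>A\<close> leads \<open>A # v\<close>, hence also the equivalent suffix, and so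
  belongs to its head \<open>w ! i\<close>.\<close>

lemma step_foataI:
  assumes "sym ind"
    and dep: "\<And>i a. Suc i < length w \<Longrightarrow> a \<in> w ! Suc i \<Longrightarrow> \<exists>b \<in> w ! i. (a, b) \<notin> ind"
  shows "step_foata \<Sigma> ind w"
  unfolding step_foata_def
proof (intro allI impI ballI subsetI)
  fix i A v a
  assume i: "i < length w" and eq: "step_trace_equiv \<Sigma> ind (A # v) (drop i w)" and "a \<in> A"
  then have "can_lead ind a (drop i w)"
    using can_lead_step_trace_equiv[OF assms(1) eq, of a] by simp
  then have "a \<in> hd (drop i w)"
  proof (rule can_lead_imp_in_hd[rotated])
    fix j b assume "Suc j < length (drop i w)" "b \<in> drop i w ! Suc j"
    then show "\<exists>c \<in> drop i w ! j. (b, c) \<notin> ind"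
      using dep[of "i + j" b] by simp
  qed
  with i show "a \<in> w ! i"
    by (simp add: hd_drop_conv_nth)
qed

lemma indep_word_distinct:
  assumes "irrefl ind" and "indep_word ind u"
  shows "distinct u"
  using assms unfolding indep_word_def distinct_conv_nth irrefl_def by metis

lemma indep_word_pairwise:
  assumes "indep_word ind u"
  shows "pairwise (\<lambda>a b. (a, b) \<in> ind) (set u)"
  using assms unfolding indep_word_def pairwise_def by (metis in_set_conv_nth)

text \<open>At an adjacent descent the two letters are independent, so exchanging them stays in the
  trace class and gives a smaller word.\<close>

lemma lex_minimal_imp_sorted:
  assumes "u \<in> lists \<Sigma>" and "indep_word ind u" and "lex_minimal \<Sigma> ind u"
  shows "sorted u"
proof (rule ccontr)
  assume "\<not> sorted u"
  then obtain i where i: "Suc i < length u" and less: "u ! Suc i < u ! i"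
    by (auto simp: sorted_iff_nth_Suc not_le)
  define p a b z where "p = take i u" and "a = u ! i" and "b = u ! Suc i"
    and "z = drop (Suc (Suc i)) u"
  have u: "u = p @ [a, b] @ z"
    unfolding p_def a_def b_def z_def using i
    by (simp add: Cons_nth_drop_Suc)
  have "(a, b) \<in> ind"
    using assms(2) i unfolding indep_word_def a_def b_def by simp
  then have "swap_adjacent \<Sigma> ind u (p @ [b, a] @ z)"
    using assms(1) u unfolding swap_adjacent_def by auto
  then have "p @ [b, a] @ z \<in> trace_class \<Sigma> ind u"
    using assms(1) u unfolding trace_class_def trace_equiv_def by auto
  then have "lexordp_eq u (p @ [b, a] @ z)"
    using assms(3) unfolding lex_minimal_def by blast
  \<comment> \<open>Cancelling the common prefix leaves \<open>a\<close> against \<open>b\<close> as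
    the deciding letters.\<close>
  moreover have "lexordp_eq (p @ x) (p @ y) \<longleftrightarrow> lexordp_eq x y" for x y
    by (induction p) auto
  ultimately have "lexordp_eq ([a, b] @ z) ([b, a] @ z)"
    using u by simp
  with less show False
    unfolding a_def b_def by auto
qed

theorem theorem2p11:
  fixes \<Sigma> :: "'a::linorder set" and ind :: "'a rel" and u :: "'a list"
  assumes "concurrent_alphabet \<Sigma> ind"
    and "u \<in> lists \<Sigma>"
    and "seq_foata \<Sigma> ind u"
  shows "\<exists>w \<in> lists (steps \<Sigma> ind). step_foata \<Sigma> ind w \<and> u = lex_steps w"
proof -
  interpret concurrent_alphabet \<Sigma> ind by (rule assms(1))
  from assms(3) obtain us where u: "u = concat us"
    and us: "\<forall>v \<in> set us. v \<noteq> [] \<and> indep_word ind v \<and> lex_minimal \<Sigma> ind v"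
    and dep: "\<forall>i. Suc i < length us \<longrightarrow>
      (\<forall>a \<in> set (us ! Suc i). \<exists>b \<in> set (us ! i). (a, b) \<in> dep \<Sigma> ind)"
    unfolding seq_foata_def by (elim exE conjE)
  have letters: "v \<in> lists \<Sigma>" if "v \<in> set us" for v
    using assms(2) that unfolding u by auto
  have "map set us \<in> lists (steps \<Sigma> ind)"
    using us letters by (auto simp: steps_def indep_word_pairwise in_lists_conv_set)
  moreover have "step_foata \<Sigma> ind (map set us)"
  proof (rule step_foataI[OF sym_ind])
    fix i a assume "Suc i < length (map set us)" "a \<in> map set us ! Suc i"
    then show "\<exists>b \<in> map set us ! i. (a, b) \<notin> ind"
      using dep by (fastforce simp: dep_def)
  qed
  \<comment> \<open>Besides being sorted, \<open>v\<close> must not repeat a letter; irreflexivity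
    of \<open>ind\<close> ensures this.\<close>
  moreover have "sorted_list_of_set (set v) = v" if "v \<in> set us" for v
    using bspec[OF us that] lex_minimal_imp_sorted[OF letters[OF that]]
      indep_word_distinct[OF irrefl_ind]
    by (blast intro: sorted_list_of_set.idem_if_sorted_distinct)
  then have "u = lex_steps (map set us)"
    unfolding u lex_steps_def by (simp add: map_idI comp_def)
  ultimately show ?thesis by blast
qed

end
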